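(* If the individual preferences are transitive, then for every option $x\in A$: $R_x=1$ if and only if $v_{xy}=1$ for every $y\in A$ with $y\neq x$.
   Context: Let $A$ be a finite set of $N$ options and $\Pi=\{(x,y)\in A\times A : x\neq y\}$; a pair $(x,y)$ is written $xy$. Let $\Omega=\{v\in[0,1]^{\Pi} : v_{xy}+v_{yx}\le 1 \text{ for all } xy\in\Pi\}$; its elements are called Llull matrices. For $v\in\Omega$ put $t_{xy}=v_{xy}+v_{yx}$ (turnouts). Individual preferences: the collective Llull matrix is $v=\sum_k\alpha_k v^k$ (finite sum), where $\alpha_k>0$, $\sum_k\alpha_k=1$, are the relative frequencies of the individual votes $v^k$. Each individual vote is a binary relation $\rho_k\subseteq\Pi$, with $v^k_{xy}=1$ if $xy\in\rho_k$ and $yx\notin\rho_k$ (strict preference), $v^k_{xy}=1/2$ if both $xy,yx\in\rho_k$ (tie), and $v^k_{xy}=0$ otherwise; "the individual preferences are transitive" means that each $\rho_k$ is transitive ($xy,yz\in\rho_k$ and $x\ne z$ imply $xz\in\rho_k$). CLC procedure applied to $v\in\Omega$: (1) Indirect scores: $v^*_{xy}=\max\min_{0\le i<n} v_{x_ix_{i+1}}$, the maximum being over all paths $x_0x_1\dots x_n$ ($n\ge1$, consecutive elements distinct) in $A$ with $x_0=x$, $x_n=y$. Indirect margins: $m^{\kappa}_{xy}=v^*_{xy}-v^*_{yx}$. (2) Indirect comparison relation: $\kappa=\{xy\in\Pi : m^{\kappa}_{xy}>0\}$ (it is transitive). An admissible order is any strict total order $\xi\subseteq\Pi$ on $A$ with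 $\kappa\subseteq\xi$. Fix an admissible order $\xi$. Write $x\succ_\xi y$ for $xy\in\xi$, and $x\succeq_\xi y$ for ($xy\in\xi$ or $x=y$). For $x$ not last in $\xi$, $x'$ denotes the immediate successor of $x$ in $\xi$ (the element following $x$). (3) For each non-last $x$: $m^{\sigma}_{xx'}=\min\{m^{\kappa}_{pq} : p\succeq_\xi x,\ x'\succeq_\xi q\}$. (4) $(t^{\sigma}_{xy})$ is the unique minimizer of $\sum_{x}\sum_{y\neq x}(\tau_{xy}-t_{xy})^2$ over all $\tau\in\mathbb{R}^{\Pi}$ satisfying: $\tau_{xy}=\tau_{yx}$ for all $xy\in\Pi$; $m^{\sigma}_{xx'}\le\tau_{xx'}\le1$ for all non-last $x$; and $0\le\tau_{xz}-\tau_{x'z}\le m^{\sigma}_{xx'}$ for all non-last $x$ and all $z\notin\{x,x'\}$. (5) Projected scores: $v^{\pi}_{xx'}=(t^{\sigma}_{xx'}+m^{\sigma}_{xx'})/2$, $v^{\pi}_{x'x}=(t^{\sigma}_{xx'}-m^{\sigma}_{xx'})/2$, and for $x\succ_\xi y$: $v^{\pi}_{xy}=\max\{v^{\pi}_{pp'} : x\succeq_\xi p\succ_\xi y\}$, $v^{\pi}_{yx}=\min\{v^{\pi}_{p'p} : x\succeq_\xi p\succ_\xi y\}$. (6) Rank-like rates: $R_x=N-\sum_{y\neq x}v^{\pi}_{xy}$. The projected scores and rank-like rates do not depend on the choice of the admissible order $\xi$, so they are functions of $v$. *)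

theory Defs
  imports Complex_Main
begin

text \<open>
  Families indexed by ordered pairs of distinct options are functions
  \<^typ>\<open>'a \<Rightarrow> 'a \<Rightarrow> real\<close>, of which only the values on \<open>option_pairs A\<close> matter.
  Orders and preferences are sets of pairs, \<open>(x, y)\<close> meaning that \<open>x\<close> is preferred to \<open>y\<close>.
\<close>

definition option_pairs :: "'a set \<Rightarrow> ('a \<times> 'a) set" where
  "option_pairs A = {(x, y). x \<in> A \<and> y \<in> A \<and> x \<noteq> y}"

definition vote_score :: "('a \<times> 'a) set \<Rightarrow> 'a \<Rightarrow> 'a \<Rightarrow> real" where
  "vote_score \<rho> x y =
    (if (x, y) \<in> \<rho> \<and> (y, x) \<notin> \<rho> then 1
     else if (x, y) \<in> \<rho> \<and> (y, x) \<in> \<rho> then 1 / 2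
     else 0)"

text \<open>Unlike \<^const>\<open>trans\<close>, the following does not force \<open>(x, x) \<in> \<rho>\<close> when \<open>x\<close> is tied
  with another option; preferences are irreflexive by convention.\<close>

definition transitive_preference :: "('a \<times> 'a) set \<Rightarrow> bool" where
  "transitive_preference \<rho> \<longleftrightarrow>
    (\<forall>x y z. (x, y) \<in> \<rho> \<and> (y, z) \<in> \<rho> \<and> x \<noteq> z \<longrightarrow> (x, z) \<in> \<rho>)"

definition option_paths :: "'a set \<Rightarrow> 'a \<Rightarrow> 'a \<Rightarrow> 'a list set" where
  "option_paths A x y =
    {xs. 2 \<le> length xs \<and> set xs \<subseteq> A \<and> successively (\<noteq>) xs \<and> hd xs = x \<and> last xs = y}"

definition path_score :: "('a \<Rightarrow> 'a \<Rightarrow> real) \<Rightarrow> 'a list \<Rightarrow> real" where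
  "path_score v xs = Min {v (xs ! i) (xs ! Suc i) | i. Suc i < length xs}"

text \<open>For finite \<open>A\<close> there may be infinitely many paths, but their scores take only finitely
  many values, so that the maximum is meaningful.\<close>

definition indirect_score :: "'a set \<Rightarrow> ('a \<Rightarrow> 'a \<Rightarrow> real) \<Rightarrow> 'a \<Rightarrow> 'a \<Rightarrow> real" where
  "indirect_score A v x y = Max (path_score v ` option_paths A x y)"

definition indirect_margin :: "'a set \<Rightarrow> ('a \<Rightarrow> 'a \<Rightarrow> real) \<Rightarrow> 'a \<Rightarrow> 'a \<Rightarrow> real" where
  "indirect_margin A v x y = indirect_score A v x y - indirect_score A v y x"

definition indirect_comparison :: "'a set \<Rightarrow> ('a \<Rightarrow> 'a \<Rightarrow> real) \<Rightarrow> ('a \<times> 'a) set" where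
  "indirect_comparison A v = {(x, y) \<in> option_pairs A. indirect_margin A v x y > 0}"

definition admissible_order :: "'a set \<Rightarrow> ('a \<Rightarrow> 'a \<Rightarrow> real) \<Rightarrow> ('a \<times> 'a) set \<Rightarrow> bool" where
  "admissible_order A v \<xi> \<longleftrightarrow>
    \<xi> \<subseteq> option_pairs A \<and> strict_linear_order_on A \<xi> \<and> indirect_comparison A v \<subseteq> \<xi>"

definition weakly_above :: "('a \<times> 'a) set \<Rightarrow> 'a \<Rightarrow> 'a \<Rightarrow> bool" where
  "weakly_above \<xi> x y \<longleftrightarrow> (x, y) \<in> \<xi> \<or> x = y"

text \<open>The immediate successor; meaningful only for \<open>x \<in> Domain \<xi>\<close>, i.e. \<open>x\<close> not last.\<close>

definition next_option :: "('a \<times> 'a) set \<Rightarrow> 'a \<Rightarrow> 'a" where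
  "next_option \<xi> x = (THE y. (x, y) \<in> \<xi> \<and> \<not> (\<exists>z. (x, z) \<in> \<xi> \<and> (z, y) \<in> \<xi>))"

text \<open>\<open>projected_margin A v \<xi> x\<close> is $m^\sigma_{xx'}$, where $x'$ is the successor of $x$.\<close>

definition projected_margin ::
    "'a set \<Rightarrow> ('a \<Rightarrow> 'a \<Rightarrow> real) \<Rightarrow> ('a \<times> 'a) set \<Rightarrow> 'a \<Rightarrow> real" where
  "projected_margin A v \<xi> x =
    Min {indirect_margin A v p q | p q. weakly_above \<xi> p x \<and> weakly_above \<xi> (next_option \<xi> x) q}"

text \<open>The first conjunct only normalizes the irrelevant values outside \<open>option_pairs A\<close>, so that
  functions stand for elements of $\mathbb{R}^\Pi$ and the minimizer below is unique.\<close>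

definition feasible_turnouts ::
    "'a set \<Rightarrow> ('a \<Rightarrow> 'a \<Rightarrow> real) \<Rightarrow> ('a \<times> 'a) set \<Rightarrow> ('a \<Rightarrow> 'a \<Rightarrow> real) \<Rightarrow> bool" where
  "feasible_turnouts A v \<xi> \<tau> \<longleftrightarrow>
    (\<forall>x y. (x, y) \<notin> option_pairs A \<longrightarrow> \<tau> x y = 0) \<and>
    (\<forall>(x, y) \<in> option_pairs A. \<tau> x y = \<tau> y x) \<and>
    (\<forall>x \<in> Domain \<xi>. projected_margin A v \<xi> x \<le> \<tau> x (next_option \<xi> x) \<and>
                       \<tau> x (next_option \<xi> x) \<le> 1) \<and>
    (\<forall>x \<in> Domain \<xi>. \<forall>z \<in> A - {x, next_option \<xi> x}.
        0 \<le> \<tau> x z - \<tau> (next_option \<xi> x) z \<and>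
        \<tau> x z - \<tau> (next_option \<xi> x) z \<le> projected_margin A v \<xi> x)"

definition projected_turnouts ::
    "'a set \<Rightarrow> ('a \<Rightarrow> 'a \<Rightarrow> real) \<Rightarrow> ('a \<times> 'a) set \<Rightarrow> 'a \<Rightarrow> 'a \<Rightarrow> real" where
  "projected_turnouts A v \<xi> =
    (THE \<tau>. is_arg_min (\<lambda>\<tau>. \<Sum>x\<in>A. \<Sum>y\<in>A - {x}. (\<tau> x y - (v x y + v y x))\<^sup>2)
              (feasible_turnouts A v \<xi>) \<tau>)"

text \<open>\<open>forward_score A v \<xi> p\<close> and \<open>backward_score A v \<xi> p\<close> are the projected scores
  $v^\pi_{pp'}$ and $v^\pi_{p'p}$ of the consecutive pair $p, p'$.\<close>

definition forward_score ::
    "'a set \<Rightarrow> ('a \<Rightarrow> 'a \<Rightarrow> real) \<Rightarrow> ('a \<times> 'a) set \<Rightarrow> 'a \<Rightarrow> real" where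
  "forward_score A v \<xi> p =
    (projected_turnouts A v \<xi> p (next_option \<xi> p) + projected_margin A v \<xi> p) / 2"

definition backward_score ::
    "'a set \<Rightarrow> ('a \<Rightarrow> 'a \<Rightarrow> real) \<Rightarrow> ('a \<times> 'a) set \<Rightarrow> 'a \<Rightarrow> real" where
  "backward_score A v \<xi> p =
    (projected_turnouts A v \<xi> p (next_option \<xi> p) - projected_margin A v \<xi> p) / 2"

text \<open>For consecutive options the maximum and minimum range over a single element.\<close>

definition projected_score ::
    "'a set \<Rightarrow> ('a \<Rightarrow> 'a \<Rightarrow> real) \<Rightarrow> ('a \<times> 'a) set \<Rightarrow> 'a \<Rightarrow> 'a \<Rightarrow> real" where
  "projected_score A v \<xi> x y =
    (if (x, y) \<in> \<xi> then Max (forward_score A v \<xi> ` {p. weakly_above \<xi> x p \<and> (p, y) \<in> \<xi>})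
     else Min (backward_score A v \<xi> ` {p. weakly_above \<xi> y p \<and> (p, x) \<in> \<xi>}))"

definition rank_like_rate ::
    "'a set \<Rightarrow> ('a \<Rightarrow> 'a \<Rightarrow> real) \<Rightarrow> ('a \<times> 'a) set \<Rightarrow> 'a \<Rightarrow> real" where
  "rank_like_rate A v \<xi> x = real (card A) - (\<Sum>y\<in>A - {x}. projected_score A v \<xi> x y)"

end

theory Submission
  imports Defs
begin

text \<open>
  The constant turnout \<open>1\<close> is feasible, so the projected turnouts exist, lie below \<open>1\<close>, and no
  projected score exceeds \<open>1\<close>; moreover \<open>v\<^sup>\<pi>\<^sub>y\<^sub>x \<le> 1/2\<close> for \<open>(x, y) \<in> \<xi>\<close>. Hence the rate of
  \<open>x\<close> is \<open>1\<close> exactly when all \<open>v\<^sup>\<pi>\<^sub>x\<^sub>y\<close> equal \<open>1\<close>, which happens exactly when \<open>x\<close> is first in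
  \<open>\<xi>\<close> with projected margin \<open>1\<close> over its successor, that is, when all indirect margins of \<open>x\<close>
  are \<open>1\<close>. An indirect score \<open>1\<close> comes from a path all of whose steps are unanimous strict
  preferences; by transitivity of the individual preferences its endpoints are then also in
  unanimous strict preference.
\<close>

section \<open>Least squares projection\<close>

text \<open>Parallelogram identity for \<open>g - t\<close> and \<open>h - t\<close>, summed over
  \<open>I\<close>.\<close>

lemma sum_square_midpoint:
  fixes g h t :: "'a \<Rightarrow> 'b \<Rightarrow> real"
  shows "(\<Sum>(x, y)\<in>I. ((g x y + h x y) / 2 - t x y)\<^sup>2) =
    ((\<Sum>(x, y)\<in>I. (g x y - t x y)\<^sup>2) + (\<Sum>(x, y)\<in>I. (h x y - t x y)\<^sup>2)) / 2
      - (\<Sum>(x, y)\<in>I. (g x y - h x y)\<^sup>2) / 4"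
proof -
  have "(\<Sum>(x, y)\<in>I. ((g x y + h x y) / 2 - t x y)\<^sup>2) =
    (\<Sum>(x, y)\<in>I. ((g x y - t x y)\<^sup>2 + (h x y - t x y)\<^sup>2) / 2 - (g x y - h x y)\<^sup>2 / 4)"
    by (intro sum.cong) (auto simp: power2_eq_square field_simps)
  then show ?thesis
    by (simp add: case_prod_unfold sum_subtractf sum.distrib flip: sum_divide_distrib)
qed

text \<open>The Hilbert space projection argument: by the parallelogram identity a minimizing
  sequence is Cauchy in every coordinate, and closedness puts its limit in \<open>P\<close>.
  Convexity enters only through midpoints and closedness through pointwise limits;
  \<open>support\<close> fixes the coordinates outside \<open>I\<close>, so that the minimizer is
  unique as a function.\<close>

lemma ex1_least_squares:
  fixes t :: "'a \<Rightarrow> 'b \<Rightarrow> real" and P :: "('a \<Rightarrow> 'b \<Rightarrow> real) \<Rightarrow> bool"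
  assumes fin: "finite I"
    and nonempty: "P g0"
    and support: "\<And>g x y. P g \<Longrightarrow> (x, y) \<notin> I \<Longrightarrow> g x y = 0"
    and midpoint: "\<And>g h. P g \<Longrightarrow> P h \<Longrightarrow> P (\<lambda>x y. (g x y + h x y) / 2)"
    and limit: "\<And>X g. (\<And>n. P (X n)) \<Longrightarrow> (\<And>x y. (\<lambda>n. X n x y) \<longlonglongrightarrow> g x y) \<Longrightarrow> P g"
  shows "\<exists>!g. is_arg_min (\<lambda>g. \<Sum>(x, y)\<in>I. (g x y - t x y)\<^sup>2) P g"
proof -
  define f where "f g = (\<Sum>(x, y)\<in>I. (g x y - t x y)\<^sup>2)" for g
  define d where "d = Inf (f ` Collect P)"
  have "0 \<le> f g" for g
    unfolding f_def by (intro sum_nonneg) auto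
  then have bdd: "bdd_below (f ` Collect P)"
    by (intro bdd_belowI[of _ 0]) auto
  have lower: "d \<le> f g" if "P g" for g
    unfolding d_def using that bdd by (intro cInf_lower) auto
  \<comment> \<open>Two nearly optimal members of \<open>P\<close> are close in each coordinate,
    because their midpoint cannot have objective below \<open>d\<close>. This gives both the Cauchy
    property and uniqueness.\<close>
  have close: "(g x y - h x y)\<^sup>2 \<le> 2 * (f g - d) + 2 * (f h - d)" if "P g" "P h" for g h x y
  proof (cases "(x, y) \<in> I")
    case True
    define s where "s = (\<Sum>(x, y)\<in>I. (g x y - h x y)\<^sup>2)"
    have "(g x y - h x y)\<^sup>2 \<le> s"
      unfolding s_def using member_le_sum[OF True, of "\<lambda>(x, y). (g x y - h x y)\<^sup>2"] fin
      by (auto simp: case_prod_unfold)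
    moreover have "d \<le> f (\<lambda>x y. (g x y + h x y) / 2)"
      by (intro lower midpoint that)
    moreover have "f (\<lambda>x y. (g x y + h x y) / 2) = (f g + f h) / 2 - s / 4"
      unfolding f_def s_def by (rule sum_square_midpoint)
    ultimately show ?thesis
      by (simp add: field_simps)
  next
    case False
    then show ?thesis
      using support[OF that(1) False] support[OF that(2) False] lower[OF that(1)] lower[OF that(2)]
      by simp
  qed
  have "\<exists>g. P g \<and> f g < d + 1 / real (Suc n)" for n
  proof -
    have "\<exists>z\<in>f ` Collect P. z < d + 1 / real (Suc n)"
      using nonempty bdd unfolding d_def by (subst cInf_less_iff[symmetric]) auto
    then show ?thesis by auto
  qed
  then obtain X where X: "\<And>n. P (X n)" "\<And>n. f (X n) < d + 1 / real (Suc n)"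
    by metis
  have "Cauchy (\<lambda>n. X n x y)" for x y
  proof (rule CauchyI)
    fix e :: real
    assume "0 < e"
    \<comment> \<open>With both gaps below \<open>e\<^sup>2 / 4\<close>, the bound of
      \<open>close\<close> stays below \<open>e\<^sup>2\<close>.\<close>
    then obtain M where M: "1 / real (Suc M) < e\<^sup>2 / 4"
      using nat_approx_posE[of "e\<^sup>2 / 4"] by auto
    have gap: "f (X n) - d < e\<^sup>2 / 4" if "M \<le> n" for n
    proof -
      have "1 / real (Suc n) \<le> 1 / real (Suc M)"
        using that by (intro divide_left_mono) auto
      then show ?thesis using M X(2)[of n] by linarith
    qed
    have "norm (X m x y - X n x y) < e" if "M \<le> m" "M \<le> n" for m n
    proof -
      have "(X m x y - X n x y)\<^sup>2 \<le> 2 * (f (X m) - d) + 2 * (f (X n) - d)"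
        by (intro close X)
      also have "\<dots> < 2 * (e\<^sup>2 / 4) + 2 * (e\<^sup>2 / 4)"
        using gap that by (intro add_strict_mono mult_strict_left_mono) auto
      finally have "(X m x y - X n x y)\<^sup>2 < e\<^sup>2"
        by simp
      then show ?thesis
        using \<open>0 < e\<close> by (auto intro: power2_less_imp_less[of "\<bar>X m x y - X n x y\<bar>"])
    qed
    then show "\<exists>M. \<forall>m\<ge>M. \<forall>n\<ge>M. norm (X m x y - X n x y) < e"
      by blast
  qed
  then have "\<exists>l. (\<lambda>n. X n x y) \<longlonglongrightarrow> l" for x y
    using Cauchy_convergent_iff convergent_def by blast
  then obtain g where g: "\<And>x y. (\<lambda>n. X n x y) \<longlonglongrightarrow> g x y"
    by metis
  have "P g"
    using X(1) g by (rule limit)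
  have "(\<lambda>n. f (X n)) \<longlonglongrightarrow> f g"
    unfolding f_def case_prod_unfold by (intro tendsto_intros g)
  moreover have "(\<lambda>n. d + 1 / real (Suc n)) \<longlonglongrightarrow> d + 0"
    using LIMSEQ_inverse_real_of_nat by (intro tendsto_intros) (simp add: inverse_eq_divide)
  ultimately have "f g \<le> d + 0"
    by (rule LIMSEQ_le) (use X(2) less_imp_le in blast)
  then have "is_arg_min f P g"
    using \<open>P g\<close> lower unfolding is_arg_min_def by fastforce
  \<comment> \<open>Two minimizers have no gap above \<open>d\<close>, so \<open>close\<close> makes
    their squared difference at most 0 in every coordinate.\<close>
  moreover have "h = g" if "is_arg_min f P h" for h
  proof -
    have "P h" "f h \<le> d"
      using that \<open>P g\<close> \<open>f g \<le> d + 0\<close> unfolding is_arg_min_def by force+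
    then have "2 * (f h - d) + 2 * (f g - d) \<le> 0"
      using \<open>f g \<le> d + 0\<close> by simp
    then have "(h x y - g x y)\<^sup>2 \<le> 0" for x y
      using close[OF \<open>P h\<close> \<open>P g\<close>] order_trans by blast
    then show ?thesis by (intro ext) simp
  qed
  ultimately show ?thesis
    unfolding f_def by blast
qed

section \<open>Indirect scores\<close>

lemma finite_option_pairs: "finite A \<Longrightarrow> finite (option_pairs A)"
  by (rule finite_subset[of _ "A \<times> A"]) (auto simp: option_pairs_def)

lemma option_path_step:
  assumes "xs \<in> option_paths A x y" "Suc i < length xs"
  shows "(xs ! i, xs ! Suc i) \<in> option_pairs A"
proof -
  have "xs ! i \<in> A" "xs ! Suc i \<in> A"
    using assms nth_mem[of i xs] nth_mem[of "Suc i" xs] by (auto simp: option_paths_def)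
  then show ?thesis
    using assms by (auto simp: option_paths_def option_pairs_def successively_conv_nth)
qed

lemma finite_path_steps: "finite {v (xs ! i) (xs ! Suc i) | i. Suc i < length xs}"
  by (rule finite_image_set) (rule finite_subset[of _ "{..<length xs}"], auto)

lemma path_score_le:
  assumes "Suc i < length xs"
  shows "path_score v xs \<le> v (xs ! i) (xs ! Suc i)"
  unfolding path_score_def using assms by (intro Min_le finite_path_steps) auto

lemma path_score_step:
  assumes "2 \<le> length xs"
  obtains i where "Suc i < length xs" "path_score v xs = v (xs ! i) (xs ! Suc i)"
proof -
  let ?S = "{v (xs ! i) (xs ! Suc i) | i. Suc i < length xs}"
  have "v (xs ! 0) (xs ! Suc 0) \<in> ?S"
    using assms by (intro CollectI exI[of _ 0]) auto
  then have "Min ?S \<in> ?S"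
    by (intro Min_in finite_path_steps) auto
  then show ?thesis
    using that unfolding path_score_def by blast
qed

text \<open>Each path score is the value of \<open>v\<close> at some step of the path, hence at one
  of finitely many option pairs, although paths can be arbitrarily long.\<close>

lemma finite_path_scores:
  assumes "finite A"
  shows "finite (path_score v ` option_paths A x y)"
proof (rule finite_subset)
  show "path_score v ` option_paths A x y \<subseteq> (\<lambda>(a, b). v a b) ` option_pairs A"
  proof
    fix s assume "s \<in> path_score v ` option_paths A x y"
    then obtain xs where xs: "xs \<in> option_paths A x y" "s = path_score v xs"
      by blast
    obtain i where "Suc i < length xs" "path_score v xs = v (xs ! i) (xs ! Suc i)"
      using xs path_score_step[of xs v] by (auto simp: option_paths_def)
    then show "s \<in> (\<lambda>(a, b). v a b) ` option_pairs A"
      using xs option_path_step[OF xs(1)] by force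
  qed
qed (simp add: assms finite_option_pairs)

lemma direct_path:
  assumes "(x, y) \<in> option_pairs A"
  shows "[x, y] \<in> option_paths A x y" "path_score v [x, y] = v x y"
proof -
  show "[x, y] \<in> option_paths A x y"
    using assms by (auto simp: option_paths_def option_pairs_def)
  have "{v ([x, y] ! i) ([x, y] ! Suc i) | i. Suc i < length [x, y]} = {v x y}"
    by auto
  then show "path_score v [x, y] = v x y"
    by (simp add: path_score_def)
qed

lemma indirect_score_ge:
  assumes "finite A" "(x, y) \<in> option_pairs A"
  shows "v x y \<le> indirect_score A v x y"
  unfolding indirect_score_def
proof (rule Max_ge)
  show "v x y \<in> path_score v ` option_paths A x y"
    using direct_path[OF assms(2)] by (metis image_eqI)
qed (rule finite_path_scores[OF assms(1)])

lemma indirect_score_attained: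
  assumes "finite A" "(x, y) \<in> option_pairs A"
  obtains xs where "xs \<in> option_paths A x y" "indirect_score A v x y = path_score v xs"
proof -
  have "indirect_score A v x y \<in> path_score v ` option_paths A x y"
    unfolding indirect_score_def
    using finite_path_scores[OF assms(1)] direct_path(1)[OF assms(2)] by (intro Max_in) auto
  then show ?thesis using that by blast
qed

text \<open>A best path is no stronger than its last step. This yields the bound 1 on indirect
  scores, and makes all indirect scores into an option small when all direct scores into it
  are.\<close>

lemma indirect_score_le_last_step:
  assumes "finite A" "(x, y) \<in> option_pairs A"
  obtains z where "(z, y) \<in> option_pairs A" "indirect_score A v x y \<le> v z y"
proof -
  obtain xs where xs: "xs \<in> option_paths A x y" "indirect_score A v x y = path_score v xs"
    using assms by (rule indirect_score_attained)
  \<comment> \<open>Start of the last step: the last vertex has index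
    \<open>length xs - 1\<close>.\<close>
  define i where "i = length xs - 2"
  have "2 \<le> length xs" "xs \<noteq> []" "last xs = y"
    using xs(1) by (auto simp: option_paths_def)
  then have i: "Suc i < length xs" "xs ! Suc i = y"
    by (auto simp: i_def last_conv_nth simp flip: Suc_diff_le)
  then show ?thesis
    using that[of "xs ! i"] option_path_step[OF xs(1) i(1)] path_score_le[OF i(1), of v] xs(2)
    by simp
qed

section \<open>Unanimous strict preference\<close>

lemma vote_score_bounds: "0 \<le> vote_score \<rho> x y" "vote_score \<rho> x y \<le> 1"
  by (auto simp: vote_score_def)

lemma vote_score_turnout: "vote_score \<rho> x y + vote_score \<rho> y x \<le> 1"
  by (auto simp: vote_score_def)

lemma vote_score_eq_1_iff: "vote_score \<rho> x y = 1 \<longleftrightarrow> (x, y) \<in> \<rho> \<and> (y, x) \<notin> \<rho>"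
  by (auto simp: vote_score_def)

text \<open>If \<open>(z, x)\<close> were in \<rho>, composing it with \<open>(x, y)\<close> would
  give \<open>(z, y)\<close> in \<rho>, against the strict preference of \<open>y\<close> to
  \<open>z\<close>. Distinctness of the endpoints comes first, as
  \<open>transitive_preference\<close> composes pairs only then.\<close>

lemma strict_preference_trans:
  assumes "transitive_preference \<rho>"
    and "vote_score \<rho> x y = 1" "vote_score \<rho> y z = 1"
  shows "x \<noteq> z" "vote_score \<rho> x z = 1"
proof -
  show "x \<noteq> z"
    using assms(2,3) by (auto simp: vote_score_eq_1_iff)
  then show "vote_score \<rho> x z = 1"
    using assms unfolding vote_score_eq_1_iff transitive_preference_def by metis
qed

text \<open>The shortfall from 1 is the sum of the nonnegative terms
  \<open>\<alpha> k * (1 - s k)\<close>; since the weights are positive, it vanishes only if every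
  \<open>s k\<close> is 1.\<close>

lemma weighted_mean_eq_1_iff:
  fixes \<alpha> s :: "'k \<Rightarrow> real"
  assumes "finite K" "\<And>k. k \<in> K \<Longrightarrow> \<alpha> k > 0" "sum \<alpha> K = 1" "\<And>k. k \<in> K \<Longrightarrow> s k \<le> 1"
  shows "(\<Sum>k\<in>K. \<alpha> k * s k) = 1 \<longleftrightarrow> (\<forall>k\<in>K. s k = 1)"
proof -
  have "(\<Sum>k\<in>K. \<alpha> k * s k) = 1 \<longleftrightarrow> (\<Sum>k\<in>K. \<alpha> k * (1 - s k)) = 0"
    using assms(3) by (auto simp: right_diff_distrib sum_subtractf)
  also have "\<dots> \<longleftrightarrow> (\<forall>k\<in>K. \<alpha> k * (1 - s k) = 0)"
    using assms(2,4) by (intro sum_nonneg_eq_0_iff assms(1) mult_nonneg_nonneg) (auto simp: less_imp_le)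
  also have "\<dots> \<longleftrightarrow> (\<forall>k\<in>K. s k = 1)"
    using assms(2) by fastforce
  finally show ?thesis .
qed

lemma unanimous_along_path:
  assumes xs: "xs \<in> option_paths A x y"
    and step: "\<And>i. Suc i < length xs \<Longrightarrow> \<forall>k\<in>K. vote_score (\<rho> k) (xs ! i) (xs ! Suc i) = 1"
    and trans: "\<And>k. k \<in> K \<Longrightarrow> transitive_preference (\<rho> k)"
  shows "\<forall>k\<in>K. vote_score (\<rho> k) x y = 1"
proof -
  \<comment> \<open>The induction keeps the start of the path fixed and appends one step at a time,
    each vote being strictly transitive.\<close>
  have unanimous: "\<forall>k\<in>K. vote_score (\<rho> k) (xs ! 0) (xs ! Suc i) = 1" if "Suc i < length xs" for i
    using that
  proof (induction i)
    case 0
    then show ?case using step by blast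
  next
    case (Suc i)
    show ?case
    proof
      fix k assume "k \<in> K"
      then show "vote_score (\<rho> k) (xs ! 0) (xs ! Suc (Suc i)) = 1"
        using Suc step[of "Suc i"]
        by (intro strict_preference_trans(2)[OF trans, of k "xs ! 0" "xs ! Suc i" "xs ! Suc (Suc i)"])
          auto
    qed
  qed
  have "2 \<le> length xs" "xs \<noteq> []" "hd xs = x" "last xs = y"
    using xs by (auto simp: option_paths_def)
  then have "xs ! 0 = x" "2 \<le> length xs" "xs ! (length xs - 1) = y"
    by (auto simp: hd_conv_nth last_conv_nth)
  moreover from this have "Suc (length xs - 2) = length xs - 1" "length xs - 1 < length xs"
    by auto
  ultimately show ?thesis
    using unanimous[of "length xs - 2"] by simp
qed

section \<open>Projected scores\<close>

text \<open>An arbitrary Llull matrix with an arbitrary admissible order. The votes and their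
  transitivity enter only after this context.\<close>

locale llull_order =
  fixes A :: "'a set" and v :: "'a \<Rightarrow> 'a \<Rightarrow> real" and \<xi> :: "('a \<times> 'a) set"
  assumes finite_A: "finite A"
    and score_nonneg: "(x, y) \<in> option_pairs A \<Longrightarrow> 0 \<le> v x y"
    and turnout_le_1: "(x, y) \<in> option_pairs A \<Longrightarrow> v x y + v y x \<le> 1"
    and admissible: "admissible_order A v \<xi>"
begin

section \<open>The admissible order and its immediate successors\<close>

lemma xi_sub: "(x, y) \<in> \<xi> \<Longrightarrow> (x, y) \<in> option_pairs A"
  using admissible by (auto simp: admissible_order_def)

lemma xi_mem: "(x, y) \<in> \<xi> \<Longrightarrow> x \<in> A \<and> y \<in> A \<and> x \<noteq> y"
  using xi_sub by (auto simp: option_pairs_def)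

lemma xi_trans: "(x, y) \<in> \<xi> \<Longrightarrow> (y, z) \<in> \<xi> \<Longrightarrow> (x, z) \<in> \<xi>"
  using admissible transD[of \<xi> x y z]
  by (simp add: admissible_order_def strict_linear_order_on_def)

lemma xi_asym: "(x, y) \<in> \<xi> \<Longrightarrow> (y, x) \<notin> \<xi>"
  using xi_trans[of x y x] xi_mem[of x x] by blast

lemma xi_total: "x \<in> A \<Longrightarrow> y \<in> A \<Longrightarrow> x \<noteq> y \<Longrightarrow> (x, y) \<in> \<xi> \<or> (y, x) \<in> \<xi>"
  using admissible by (auto simp: admissible_order_def strict_linear_order_on_def total_on_def)

lemma score_le_1: "(x, y) \<in> option_pairs A \<Longrightarrow> v x y \<le> 1"
  using turnout_le_1[of x y] score_nonneg[of y x] by (auto simp: option_pairs_def)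

text \<open>A finite acyclic relation is well-founded, so the options below \<open>p\<close> have a
  \<open>\<xi>\<close>-minimal element. Pairs run from preferred to less preferred, so this is the
  highest option below \<open>p\<close>; totality makes it unique.\<close>

lemma next_option:
  assumes "p \<in> Domain \<xi>"
  shows "(p, next_option \<xi> p) \<in> \<xi>" "(p, z) \<in> \<xi> \<Longrightarrow> weakly_above \<xi> (next_option \<xi> p) z"
proof -
  have "\<xi>\<^sup>+ = \<xi>"
    by (rule trancl_id, rule transI) (rule xi_trans)
  then have "acyclic \<xi>"
    unfolding acyclic_def using xi_mem by blast
  moreover have "finite \<xi>"
    using admissible finite_subset[OF _ finite_option_pairs[OF finite_A]]
    by (auto simp: admissible_order_def)
  ultimately have "wf \<xi>"
    by (simp add: finite_acyclic_wf)
  moreover have "\<xi> `` {p} \<noteq> {}"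
    using assms by blast
  ultimately obtain y where "y \<in> \<xi> `` {p}" "\<And>z. (z, y) \<in> \<xi> \<Longrightarrow> z \<notin> \<xi> `` {p}"
    by (rule wfE_min') blast
  then have y: "(p, y) \<in> \<xi>" "\<And>z. (p, z) \<in> \<xi> \<Longrightarrow> (z, y) \<notin> \<xi>"
    by auto
  have "next_option \<xi> p = y"
    unfolding next_option_def
  proof (rule the_equality)
    show "(p, y) \<in> \<xi> \<and> \<not> (\<exists>z. (p, z) \<in> \<xi> \<and> (z, y) \<in> \<xi>)"
      using y by blast
    show "u = y" if "(p, u) \<in> \<xi> \<and> \<not> (\<exists>z. (p, z) \<in> \<xi> \<and> (z, u) \<in> \<xi>)" for u
      using that y xi_total xi_mem by metis
  qed
  then show "(p, next_option \<xi> p) \<in> \<xi>" "(p, z) \<in> \<xi> \<Longrightarrow> weakly_above \<xi> (next_option \<xi> p) z"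
    using y xi_total xi_mem unfolding weakly_above_def by metis+
qed

section \<open>Bounds on indirect and projected margins\<close>

lemma indirect_score_bounds:
  assumes "(x, y) \<in> option_pairs A"
  shows "0 \<le> indirect_score A v x y" "indirect_score A v x y \<le> 1"
proof -
  show "0 \<le> indirect_score A v x y"
    using indirect_score_ge[OF finite_A assms, of v] score_nonneg[OF assms] by linarith
  obtain z where "(z, y) \<in> option_pairs A" "indirect_score A v x y \<le> v z y"
    using finite_A assms by (rule indirect_score_le_last_step)
  then show "indirect_score A v x y \<le> 1"
    using score_le_1[of z y] by linarith
qed

text \<open>A negative margin would put \<open>(y, x)\<close> into the indirect comparison relation,
  hence into \<xi>, against asymmetry. The upper bound comes from scores lying between 0 and
  1.\<close>

lemma indirect_margin_bounds:
  assumes "(x, y) \<in> \<xi>"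
  shows "0 \<le> indirect_margin A v x y" "indirect_margin A v x y \<le> 1"
proof -
  have pairs: "(x, y) \<in> option_pairs A" "(y, x) \<in> option_pairs A"
    using xi_mem[OF assms] by (auto simp: option_pairs_def)
  have "(y, x) \<notin> indirect_comparison A v"
    using admissible xi_asym[OF assms] by (auto simp: admissible_order_def)
  then show "0 \<le> indirect_margin A v x y"
    using pairs(2) by (auto simp: indirect_comparison_def indirect_margin_def)
  show "indirect_margin A v x y \<le> 1"
    unfolding indirect_margin_def
    using indirect_score_bounds(2)[OF pairs(1)] indirect_score_bounds(1)[OF pairs(2)] by linarith
qed

text \<open>Every pair entering the minimum crosses the cut between \<open>x\<close> and its
  successor downwards, so the bounds for margins along \<xi> apply to it.\<close>

lemma projected_margin_pairs:
  assumes "x \<in> Domain \<xi>" "weakly_above \<xi> p x" "weakly_above \<xi> (next_option \<xi> x) q"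
  shows "(p, q) \<in> \<xi>"
  using assms(2,3) next_option(1)[OF assms(1)] xi_trans unfolding weakly_above_def by metis

lemma finite_margins:
  assumes "x \<in> Domain \<xi>"
  shows "finite {indirect_margin A v p q | p q.
    weakly_above \<xi> p x \<and> weakly_above \<xi> (next_option \<xi> x) q}"
proof (rule finite_subset)
  show "{indirect_margin A v p q | p q. weakly_above \<xi> p x \<and> weakly_above \<xi> (next_option \<xi> x) q}
    \<subseteq> (\<lambda>(p, q). indirect_margin A v p q) ` option_pairs A"
    using projected_margin_pairs[OF assms] xi_sub by fast
qed (simp add: finite_A finite_option_pairs)

lemma projected_margin_le:
  assumes "x \<in> Domain \<xi>" "weakly_above \<xi> p x" "weakly_above \<xi> (next_option \<xi> x) q"
  shows "projected_margin A v \<xi> x \<le> indirect_margin A v p q"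
  unfolding projected_margin_def by (rule Min_le) (use finite_margins assms in auto)

lemma projected_margin_attained:
  assumes "x \<in> Domain \<xi>"
  obtains p q where "weakly_above \<xi> p x" "weakly_above \<xi> (next_option \<xi> x) q"
    "projected_margin A v \<xi> x = indirect_margin A v p q"
proof -
  let ?S = "{indirect_margin A v p q | p q. weakly_above \<xi> p x \<and> weakly_above \<xi> (next_option \<xi> x) q}"
  have "?S \<noteq> {}"
    unfolding weakly_above_def by blast
  then have "projected_margin A v \<xi> x \<in> ?S"
    unfolding projected_margin_def by (intro Min_in finite_margins assms)
  then show ?thesis using that by blast
qed

lemma projected_margin_bounds:
  assumes "x \<in> Domain \<xi>"
  shows "0 \<le> projected_margin A v \<xi> x" "projected_margin A v \<xi> x \<le> 1"
proof -
  obtain p q where "weakly_above \<xi> p x" "weakly_above \<xi> (next_option \<xi> x) q"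
    and eq: "projected_margin A v \<xi> x = indirect_margin A v p q"
    using assms by (rule projected_margin_attained)
  then have "(p, q) \<in> \<xi>"
    using projected_margin_pairs[OF assms] by blast
  then show "0 \<le> projected_margin A v \<xi> x" "projected_margin A v \<xi> x \<le> 1"
    unfolding eq by (rule indirect_margin_bounds)+
qed

section \<open>Feasible turnouts and the existence of the projection\<close>

lemma feasible_sym: "feasible_turnouts A v \<xi> \<tau> \<Longrightarrow> \<tau> x y = \<tau> y x"
  by (cases "(x, y) \<in> option_pairs A") (auto simp: feasible_turnouts_def option_pairs_def)

text \<open>All differences of the constant turnout are 0, and projected margins lie between 0 and
  1.\<close>

lemma feasible_constant: "feasible_turnouts A v \<xi> (\<lambda>x y. if (x, y) \<in> option_pairs A then 1 else 0)"
proof -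
  have "x \<in> A \<and> next_option \<xi> x \<in> A \<and> x \<noteq> next_option \<xi> x" if "x \<in> Domain \<xi>" for x
    using xi_mem[OF next_option(1)[OF that]] .
  then show ?thesis
    using projected_margin_bounds unfolding feasible_turnouts_def option_pairs_def by auto
qed

text \<open>The constraints are linear equations and inequalities in \<tau>, so the feasible set is
  convex.\<close>

lemma feasible_midpoint:
  assumes "feasible_turnouts A v \<xi> g" "feasible_turnouts A v \<xi> h"
  shows "feasible_turnouts A v \<xi> (\<lambda>x y. (g x y + h x y) / 2)"
  unfolding feasible_turnouts_def
proof (intro conjI)
  show "\<forall>x y. (x, y) \<notin> option_pairs A \<longrightarrow> (g x y + h x y) / 2 = 0"
    "\<forall>(x, y)\<in>option_pairs A. (g x y + h x y) / 2 = (g y x + h y x) / 2"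
    using assms feasible_sym[OF assms(1)] feasible_sym[OF assms(2)]
    by (auto simp: feasible_turnouts_def)
  show "\<forall>x\<in>Domain \<xi>.
    projected_margin A v \<xi> x \<le> (g x (next_option \<xi> x) + h x (next_option \<xi> x)) / 2 \<and>
    (g x (next_option \<xi> x) + h x (next_option \<xi> x)) / 2 \<le> 1"
  proof
    fix x assume "x \<in> Domain \<xi>"
    then have "projected_margin A v \<xi> x \<le> g x (next_option \<xi> x)" "g x (next_option \<xi> x) \<le> 1"
      "projected_margin A v \<xi> x \<le> h x (next_option \<xi> x)" "h x (next_option \<xi> x) \<le> 1"
      using assms by (auto simp: feasible_turnouts_def)
    then show "projected_margin A v \<xi> x \<le> (g x (next_option \<xi> x) + h x (next_option \<xi> x)) / 2 \<and>
      (g x (next_option \<xi> x) + h x (next_option \<xi> x)) / 2 \<le> 1"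
      by auto
  qed
  show "\<forall>x\<in>Domain \<xi>. \<forall>z\<in>A - {x, next_option \<xi> x}.
    0 \<le> (g x z + h x z) / 2 - (g (next_option \<xi> x) z + h (next_option \<xi> x) z) / 2 \<and>
    (g x z + h x z) / 2 - (g (next_option \<xi> x) z + h (next_option \<xi> x) z) / 2
      \<le> projected_margin A v \<xi> x"
  proof (intro ballI)
    fix x z assume "x \<in> Domain \<xi>" "z \<in> A - {x, next_option \<xi> x}"
    then have "0 \<le> g x z - g (next_option \<xi> x) z"
      "g x z - g (next_option \<xi> x) z \<le> projected_margin A v \<xi> x"
      "0 \<le> h x z - h (next_option \<xi> x) z"
      "h x z - h (next_option \<xi> x) z \<le> projected_margin A v \<xi> x"
      using assms unfolding feasible_turnouts_def by blast+
    then show "0 \<le> (g x z + h x z) / 2 - (g (next_option \<xi> x) z + h (next_option \<xi> x) z) / 2 \<and>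
      (g x z + h x z) / 2 - (g (next_option \<xi> x) z + h (next_option \<xi> x) z) / 2
        \<le> projected_margin A v \<xi> x"
      by (auto simp: field_simps)
  qed
qed

text \<open>Equations and weak inequalities between finitely many coordinates survive pointwise
  limits.\<close>

lemma feasible_limit:
  assumes X: "\<And>n. feasible_turnouts A v \<xi> (X n)"
    and lim: "\<And>x y. (\<lambda>n. X n x y) \<longlonglongrightarrow> g x y"
  shows "feasible_turnouts A v \<xi> g"
  unfolding feasible_turnouts_def
proof (intro conjI allI impI ballI)
  fix x y assume "(x, y) \<notin> option_pairs A"
  then have "(\<lambda>n. X n x y) = (\<lambda>n. 0)"
    using X by (auto simp: feasible_turnouts_def)
  then show "g x y = 0"
    using lim[of x y] by (simp add: LIMSEQ_const_iff)
next
  fix e :: "'a \<times> 'a"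
  obtain x y where "e = (x, y)" by fastforce
  have "(\<lambda>n. X n x y) = (\<lambda>n. X n y x)"
    using feasible_sym[OF X] by auto
  then show "case e of (x, y) \<Rightarrow> g x y = g y x"
    using lim[of x y] lim[of y x] \<open>e = (x, y)\<close> by (auto intro: LIMSEQ_unique)
next
  fix x assume x: "x \<in> Domain \<xi>"
  show "projected_margin A v \<xi> x \<le> g x (next_option \<xi> x)"
    using X x by (intro LIMSEQ_le_const[OF lim]) (auto simp: feasible_turnouts_def)
  show "g x (next_option \<xi> x) \<le> 1"
    using X x by (intro LIMSEQ_le_const2[OF lim]) (auto simp: feasible_turnouts_def)
  fix z assume z: "z \<in> A - {x, next_option \<xi> x}"
  have diff: "(\<lambda>n. X n x z - X n (next_option \<xi> x) z) \<longlonglongrightarrow> g x z - g (next_option \<xi> x) z"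
    by (intro tendsto_intros lim)
  show "0 \<le> g x z - g (next_option \<xi> x) z"
    by (rule LIMSEQ_le_const[OF diff]) (use X x z in \<open>unfold feasible_turnouts_def, blast\<close>)
  show "g x z - g (next_option \<xi> x) z \<le> projected_margin A v \<xi> x"
    by (rule LIMSEQ_le_const2[OF diff]) (use X x z in \<open>unfold feasible_turnouts_def, blast\<close>)
qed

text \<open>Unique existence of the least squares minimizer makes the definite description in
  \<open>projected_turnouts\<close> denote it, so it inherits the constraints.\<close>

lemma feasible_projected_turnouts: "feasible_turnouts A v \<xi> (projected_turnouts A v \<xi>)"
proof -
  have "option_pairs A = Sigma A (\<lambda>x. A - {x})"
    by (auto simp: option_pairs_def)
  then have objective: "(\<Sum>x\<in>A. \<Sum>y\<in>A - {x}. (\<tau> x y - (v x y + v y x))\<^sup>2)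
      = (\<Sum>(x, y)\<in>option_pairs A. (\<tau> x y - (v x y + v y x))\<^sup>2)" for \<tau>
    using finite_A by (simp add: sum.Sigma)
  have "\<exists>!\<tau>. is_arg_min (\<lambda>\<tau>. \<Sum>(x, y)\<in>option_pairs A. (\<tau> x y - (v x y + v y x))\<^sup>2)
    (feasible_turnouts A v \<xi>) \<tau>"
  proof (rule ex1_least_squares)
    show "finite (option_pairs A)"
      using finite_A by (rule finite_option_pairs)
    show "\<And>g x y. feasible_turnouts A v \<xi> g \<Longrightarrow> (x, y) \<notin> option_pairs A \<Longrightarrow> g x y = 0"
      by (auto simp: feasible_turnouts_def)
  qed (fact feasible_constant feasible_midpoint feasible_limit)+
  from theI'[OF this] show ?thesis
    unfolding projected_turnouts_def objective is_arg_min_def by blast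
qed

lemma projected_turnouts_bounds:
  assumes "x \<in> Domain \<xi>"
  shows "projected_margin A v \<xi> x \<le> projected_turnouts A v \<xi> x (next_option \<xi> x)"
    "projected_turnouts A v \<xi> x (next_option \<xi> x) \<le> 1"
  using feasible_projected_turnouts assms by (auto simp: feasible_turnouts_def)

section \<open>Projected scores and rates\<close>

lemma forward_score_le_1: "p \<in> Domain \<xi> \<Longrightarrow> forward_score A v \<xi> p \<le> 1"
  using projected_turnouts_bounds(2)[of p] projected_margin_bounds(2)[of p]
  by (simp add: forward_score_def)

text \<open>The score averages a turnout and a margin, both at most 1. Conversely, a margin of 1
  forces turnout 1, since the turnout lies between the margin and 1.\<close>

lemma forward_score_eq_1_iff:
  "p \<in> Domain \<xi> \<Longrightarrow> forward_score A v \<xi> p = 1 \<longleftrightarrow> projected_margin A v \<xi> p = 1"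
  using projected_turnouts_bounds[of p] projected_margin_bounds(2)[of p]
  by (auto simp: forward_score_def)

lemma backward_score_le_half: "p \<in> Domain \<xi> \<Longrightarrow> backward_score A v \<xi> p \<le> 1 / 2"
  using projected_turnouts_bounds(2)[of p] projected_margin_bounds(1)[of p]
  by (simp add: backward_score_def)

lemma finite_between: "finite {p. weakly_above \<xi> x p \<and> (p, y) \<in> \<xi>}"
  by (rule finite_subset[OF _ finite_A]) (use xi_mem in auto)

lemma projected_score_forward:
  assumes "(x, y) \<in> \<xi>"
  shows "forward_score A v \<xi> x \<le> projected_score A v \<xi> x y" "projected_score A v \<xi> x y \<le> 1"
proof -
  have x: "x \<in> {p. weakly_above \<xi> x p \<and> (p, y) \<in> \<xi>}"
    using assms by (simp add: weakly_above_def)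
  then show "forward_score A v \<xi> x \<le> projected_score A v \<xi> x y"
    using assms finite_between unfolding projected_score_def by (simp add: Max_ge)
  have "Max (forward_score A v \<xi> ` {p. weakly_above \<xi> x p \<and> (p, y) \<in> \<xi>}) \<le> 1"
    using x finite_between forward_score_le_1 by (intro Max.boundedI) auto
  then show "projected_score A v \<xi> x y \<le> 1"
    using assms by (simp add: projected_score_def)
qed

text \<open>The minimum includes the term for \<open>y\<close> itself. The gap between 1/2 and 1
  later excludes any option above one whose scores are all 1.\<close>

lemma projected_score_backward:
  assumes "(y, x) \<in> \<xi>"
  shows "projected_score A v \<xi> x y \<le> 1 / 2"
proof -
  have "projected_score A v \<xi> x y \<le> backward_score A v \<xi> y"
    using assms xi_asym[OF assms] finite_between unfolding projected_score_def
    by (simp add: weakly_above_def)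
  also have "\<dots> \<le> 1 / 2"
    using assms by (intro backward_score_le_half) blast
  finally show ?thesis .
qed

lemma projected_score_next:
  assumes "x \<in> Domain \<xi>"
  shows "projected_score A v \<xi> x (next_option \<xi> x) = forward_score A v \<xi> x"
proof -
  have "{p. weakly_above \<xi> x p \<and> (p, next_option \<xi> x) \<in> \<xi>} = {x}"
    using next_option[OF assms] xi_asym xi_mem unfolding weakly_above_def by blast
  then show ?thesis
    using next_option(1)[OF assms] by (simp add: projected_score_def)
qed

lemma projected_score_le_1:
  assumes "x \<in> A" "y \<in> A" "x \<noteq> y"
  shows "projected_score A v \<xi> x y \<le> 1"
  using xi_total[OF assms] projected_score_forward(2)[of x y] projected_score_backward[of y x]
  by linarith

text \<open>There are \<open>card A - 1\<close> summands, so the rate exceeds 1 by the sum of their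
  nonnegative shortfalls from 1.\<close>

lemma rank_like_rate_eq_1_iff:
  assumes "x \<in> A"
  shows "rank_like_rate A v \<xi> x = 1 \<longleftrightarrow> (\<forall>y\<in>A - {x}. projected_score A v \<xi> x y = 1)"
proof -
  have "rank_like_rate A v \<xi> x = 1 \<longleftrightarrow> (\<Sum>y\<in>A - {x}. 1 - projected_score A v \<xi> x y) = 0"
    using assms finite_A card_Suc_Diff1[OF finite_A assms]
    by (auto simp: rank_like_rate_def sum_subtractf)
  also have "\<dots> \<longleftrightarrow> (\<forall>y\<in>A - {x}. 1 - projected_score A v \<xi> x y = 0)"
    using finite_A projected_score_le_1[OF assms] by (intro sum_nonneg_eq_0_iff) auto
  finally show ?thesis by auto
qed

lemma all_projected_scores_1_iff:
  assumes "x \<in> A"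
  shows "(\<forall>y\<in>A - {x}. projected_score A v \<xi> x y = 1) \<longleftrightarrow>
    (\<forall>y\<in>A - {x}. indirect_margin A v x y = 1)"
proof
  assume scores: "\<forall>y\<in>A - {x}. projected_score A v \<xi> x y = 1"
  show "\<forall>y\<in>A - {x}. indirect_margin A v x y = 1"
  proof
    fix y assume y: "y \<in> A - {x}"
    then have "(y, x) \<notin> \<xi>"
      using scores projected_score_backward[of y x] by force
    then have xy: "(x, y) \<in> \<xi>"
      using xi_total assms y by blast
    then have dom: "x \<in> Domain \<xi>"
      by blast
    \<comment> \<open>The score against the successor is a single forward score, not a maximum of
      several, so it determines the projected margin.\<close>
    have "next_option \<xi> x \<in> A - {x}"
      using xi_mem[OF next_option(1)[OF dom]] by auto
    then have "forward_score A v \<xi> x = 1"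
      using scores projected_score_next[OF dom] by auto
    then have "projected_margin A v \<xi> x = 1"
      using forward_score_eq_1_iff[OF dom] by blast
    moreover have "projected_margin A v \<xi> x \<le> indirect_margin A v x y"
      using dom next_option(2)[OF dom xy]
      by (intro projected_margin_le) (auto simp: weakly_above_def)
    ultimately show "indirect_margin A v x y = 1"
      using indirect_margin_bounds(2)[OF xy] by linarith
  qed
next
  assume margins: "\<forall>y\<in>A - {x}. indirect_margin A v x y = 1"
  have first: "(x, y) \<in> \<xi>" if "y \<in> A - {x}" for y
  proof -
    have "(x, y) \<in> indirect_comparison A v"
      using that margins assms by (auto simp: indirect_comparison_def option_pairs_def)
    then show ?thesis
      using admissible by (auto simp: admissible_order_def)
  qed
  show "\<forall>y\<in>A - {x}. projected_score A v \<xi> x y = 1"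
  proof
    fix y assume y: "y \<in> A - {x}"
    have xy: "(x, y) \<in> \<xi>"
      using y by (rule first)
    then have dom: "x \<in> Domain \<xi>"
      by blast
    obtain p q where pq: "weakly_above \<xi> p x" "weakly_above \<xi> (next_option \<xi> x) q"
      and eq: "projected_margin A v \<xi> x = indirect_margin A v p q"
      using dom by (rule projected_margin_attained)
    \<comment> \<open>Nothing lies above the first option, so only margins of \<open>x\<close>
      itself enter the minimum.\<close>
    have "p = x"
      using pq(1) first[of p] xi_asym[of p x] xi_mem[of p x] by (auto simp: weakly_above_def)
    moreover have "q \<in> A - {x}"
      using projected_margin_pairs[OF dom pq] xi_mem[of p q] \<open>p = x\<close> by auto
    ultimately have "projected_margin A v \<xi> x = 1"
      using margins eq by simp
    then have "forward_score A v \<xi> x = 1"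
      using forward_score_eq_1_iff[OF dom] by blast
    then show "projected_score A v \<xi> x y = 1"
      using projected_score_forward[OF xy] by linarith
  qed
qed

end

section \<open>Transfer from indirect margins to the votes\<close>

theorem corollary7p3:
  fixes A :: "'a set" and K :: "'k set"
    and \<alpha> :: "'k \<Rightarrow> real" and \<rho> :: "'k \<Rightarrow> ('a \<times> 'a) set"
    and v :: "'a \<Rightarrow> 'a \<Rightarrow> real" and \<xi> :: "('a \<times> 'a) set" and x :: 'a
  assumes "finite A"
    and "finite K"
    and "\<And>k. k \<in> K \<Longrightarrow> \<alpha> k > 0"
    and "(\<Sum>k\<in>K. \<alpha> k) = 1"
    and "\<And>k. k \<in> K \<Longrightarrow> \<rho> k \<subseteq> option_pairs A"
    and "\<And>k. k \<in> K \<Longrightarrow> transitive_preference (\<rho> k)"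
    and "\<And>x y. (x, y) \<in> option_pairs A \<Longrightarrow> v x y = (\<Sum>k\<in>K. \<alpha> k * vote_score (\<rho> k) x y)"
    and "admissible_order A v \<xi>"
    and "x \<in> A"
  shows "rank_like_rate A v \<xi> x = 1 \<longleftrightarrow> (\<forall>y\<in>A. y \<noteq> x \<longrightarrow> v x y = 1)"
proof -
  have flip: "(b, a) \<in> option_pairs A" if "(a, b) \<in> option_pairs A" for a b
    using that by (auto simp: option_pairs_def)
  interpret llull_order A v \<xi>
  proof
    fix a b assume ab: "(a, b) \<in> option_pairs A"
    show "0 \<le> v a b"
      using assms(3) vote_score_bounds(1) unfolding assms(7)[OF ab]
      by (intro sum_nonneg mult_nonneg_nonneg) (auto simp: less_imp_le)
    have "v a b + v b a = (\<Sum>k\<in>K. \<alpha> k * (vote_score (\<rho> k) a b + vote_score (\<rho> k) b a))"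
      using assms(7)[OF ab] assms(7)[OF flip[OF ab]] by (simp add: distrib_left sum.distrib)
    also have "\<dots> \<le> (\<Sum>k\<in>K. \<alpha> k)"
      using assms(3) vote_score_turnout
      by (intro sum_mono mult_left_le) (auto simp: less_imp_le)
    finally show "v a b + v b a \<le> 1"
      using assms(4) by simp
  qed (fact assms)+
  have unanimous: "v a b = 1 \<longleftrightarrow> (\<forall>k\<in>K. vote_score (\<rho> k) a b = 1)" if "(a, b) \<in> option_pairs A" for a b
    unfolding assms(7)[OF that]
    using assms(2-4) vote_score_bounds(2) by (intro weighted_mean_eq_1_iff) auto
  have "rank_like_rate A v \<xi> x = 1 \<longleftrightarrow> (\<forall>y\<in>A - {x}. indirect_margin A v x y = 1)"
    using rank_like_rate_eq_1_iff all_projected_scores_1_iff \<open>x \<in> A\<close> by simp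
  also have "\<dots> \<longleftrightarrow> (\<forall>y\<in>A. y \<noteq> x \<longrightarrow> v x y = 1)"
  proof (intro iffI ballI impI)
    fix y assume margins: "\<forall>y\<in>A - {x}. indirect_margin A v x y = 1" and "y \<in> A" "y \<noteq> x"
    then have xy: "(x, y) \<in> option_pairs A"
      using \<open>x \<in> A\<close> by (simp add: option_pairs_def)
    obtain xs where xs: "xs \<in> option_paths A x y" "indirect_score A v x y = path_score v xs"
      using \<open>finite A\<close> xy by (rule indirect_score_attained)
    have "indirect_margin A v x y = 1"
      using margins \<open>y \<in> A\<close> \<open>y \<noteq> x\<close> by blast
    \<comment> \<open>The opposite indirect score is nonnegative, so margin 1 needs a path of score
      at least 1; each of its steps then has direct score exactly 1.\<close>
    then have "1 \<le> path_score v xs"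
      using xs(2) indirect_score_bounds(1)[OF flip[OF xy]] by (simp add: indirect_margin_def)
    then have "v (xs ! i) (xs ! Suc i) = 1" if "Suc i < length xs" for i
      using path_score_le[OF that, of v] score_le_1[OF option_path_step[OF xs(1) that]] by linarith
    then have "\<forall>k\<in>K. vote_score (\<rho> k) (xs ! i) (xs ! Suc i) = 1" if "Suc i < length xs" for i
      using that unanimous option_path_step[OF xs(1)] by blast
    then have "\<forall>k\<in>K. vote_score (\<rho> k) x y = 1"
      using unanimous_along_path[OF xs(1)] assms(6) by blast
    then show "v x y = 1"
      using unanimous[OF xy] by blast
  next
    fix y assume top: "\<forall>y\<in>A. y \<noteq> x \<longrightarrow> v x y = 1" and y: "y \<in> A - {x}"
    then have xy: "(x, y) \<in> option_pairs A"
      using \<open>x \<in> A\<close> by (auto simp: option_pairs_def)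
    have "indirect_score A v x y = 1"
      using top y indirect_score_ge[OF \<open>finite A\<close> xy, of v] indirect_score_bounds(2)[OF xy]
      by (auto intro: antisym)
    \<comment> \<open>Any path back to \<open>x\<close> ends with some step from \<open>z\<close> to
      \<open>x\<close>; as \<open>v x z = 1\<close>, the turnout bound leaves at most 0 for
      it.\<close>
    moreover obtain z where z: "(z, x) \<in> option_pairs A" "indirect_score A v y x \<le> v z x"
      using \<open>finite A\<close> flip[OF xy] by (rule indirect_score_le_last_step)
    moreover have "v x z = 1"
      using top z(1) by (simp add: option_pairs_def)
    ultimately show "indirect_margin A v x y = 1"
      using turnout_le_1[OF z(1)] indirect_score_bounds(1)[OF flip[OF xy]]
      unfolding indirect_margin_def by linarith
  qed
  finally show ?thesis .
qed

end
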